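(* Let $d>0$ and consider, on an $n$-dimensional manifold $\mathscr{M}$, the Cauchy problem of the dissipative hyperbolic geometric flow $$\frac{\partial^{2}g_{ij}}{\partial t^{2}}=-2R_{ij}+2g^{pq}\frac{\partial g_{ip}}{\partial t}\frac{\partial g_{jq}}{\partial t}-\left(d+2g^{pq}\frac{\partial g_{pq}}{\partial t}\right)\frac{\partial g_{ij}}{\partial t}+\frac{1}{n-1}\left[\left(g^{pq}\frac{\partial g_{pq}}{\partial t}\right)^2+\frac{\partial g^{pq}}{\partial t}\frac{\partial g_{pq}}{\partial t}\right]g_{ij},$$ $$g_{ij}(x,0)=g^0_{ij}(x),\qquad \frac{\partial g_{ij}}{\partial t}(x,0)=k^0_{ij}(x),$$ where $g^0_{ij}$ is a Riemannian metric and $k^0_{ij}$ a symmetric tensor on $\mathscr{M}$. Suppose that there are constants $\lambda,\mu$ such that for all $x\in\mathscr{M}$ $$R_{ij}(x,0)=\lambda g_{ij}(x,0),\qquad \frac{\partial g_{ij}}{\partial t}(x,0)=\mu g_{ij}(x,0).$$ Put $$\rho(t)=1-\frac{2\lambda}{d}t-\left(\frac{\mu}{d}+\frac{2\lambda}{d^2}\right)(e^{-dt}-1).$$ If one of the following conditions is satisfied, then the evolving metric $g_{ij}(x,t)$ shrinks homothetically to a point as $t$ approaches some finite time: (a) $\lambda>0$; (b) $\lambda=0$ and $\mu<-d$; (c) $\lambda<0$, $\mu<0$ and $\rho\left(-\frac{1}{d}\ln\left(\frac{2\lambda}{2\lambda+d\mu}\right)\right)\le 0$. In all other instances, $g_{ij}(x,t)$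 is smooth and positive definite for all time. In addition, if $\lambda=0$ and $\mu=-d<0$, the metric $g_{ij}(x,t)$ evolves smoothly and is positive definite for all time, but it shrinks homothetically to a point as $t\to+\infty$.
   Context: $R_{ij}(x,t)$ is the Ricci tensor of $g_{ij}(\cdot,t)$, $g^{pq}$ is the inverse metric, and the summation convention is used. In this setting the paper takes the evolving metric in the homothetic form $g_{ij}(x,t)=\rho(t)g_{ij}(x,0)$, with $\rho(0)=1$ and $\rho'(0)=\mu$, where $\rho$ is the function displayed in the claim. "Shrinks homothetically to a point as $t$ approaches $T$" means that the conformal factor is positive for $t<T$ and tends to $0$ as $t\to T$ (with $T\in(0,\infty)$, or $T=+\infty$ in the last assertion). *)

theory Defs
  imports "HOL-Analysis.Analysis"
begin

subsection \<open>Smooth maps\<close>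

primrec Ck_on_open ::
  "nat \<Rightarrow> 'a::real_normed_vector set \<Rightarrow> ('a \<Rightarrow> 'b::real_normed_vector) \<Rightarrow> bool"
where
  "Ck_on_open 0 W f \<longleftrightarrow> continuous_on W f"
| "Ck_on_open (Suc k) W f \<longleftrightarrow>
     f differentiable_on W \<and> (\<forall>v. Ck_on_open k W (\<lambda>x. frechet_derivative f (at x) v))"

text \<open>On a set that need not be open (such as a coordinate domain times \<open>[0,\<infinity>)\<close>),
  smoothness means that the function is locally the restriction of a \<open>C\<^sup>\<infinity>\<close> function
  defined on an open set.\<close>

definition smooth_on ::
  "'a::real_normed_vector set \<Rightarrow> ('a \<Rightarrow> 'b::real_normed_vector) \<Rightarrow> bool"
where
  "smooth_on S f \<longleftrightarrow>
     (\<forall>x\<in>S. \<exists>W F. open W \<and> x \<in> W \<and> (\<forall>k. Ck_on_open k W F) \<and> (\<forall>y\<in>W \<inter> S. F y = f y))"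

subsection \<open>Smooth manifolds\<close>

text \<open>A chart is a coordinate domain together with its coordinate map. The dimension of the
  manifold is \<open>CARD('n)\<close>.\<close>

type_synonym ('a, 'n) chart = "'a set \<times> ('a \<Rightarrow> real ^ 'n)"

abbreviation chart_dom :: "('a, 'n) chart \<Rightarrow> 'a set" where
  "chart_dom c \<equiv> fst c"

abbreviation coord :: "('a, 'n) chart \<Rightarrow> 'a \<Rightarrow> real ^ 'n" where
  "coord c \<equiv> snd c"

abbreviation coord_inv :: "('a, 'n) chart \<Rightarrow> real ^ 'n \<Rightarrow> 'a" where
  "coord_inv c \<equiv> inv_into (chart_dom c) (coord c)"

definition smooth_manifold :: "'a topology \<Rightarrow> ('a, 'n::finite) chart set \<Rightarrow> bool" where
  "smooth_manifold M A \<longleftrightarrow>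
     Hausdorff_space M \<and> second_countable M \<and>
     (\<Union>c\<in>A. chart_dom c) = topspace M \<and>
     (\<forall>c\<in>A. openin M (chart_dom c) \<and> open (coord c ` chart_dom c) \<and>
        homeomorphic_map (subtopology M (chart_dom c))
          (top_of_set (coord c ` chart_dom c)) (coord c)) \<and>
     (\<forall>c\<in>A. \<forall>c'\<in>A. smooth_on (coord c ` (chart_dom c \<inter> chart_dom c')) (coord c' \<circ> coord_inv c))"

subsection \<open>Symmetric tensors and metrics in local coordinates\<close>

text \<open>A covariant 2-tensor field \<open>h\<close> is given by its components: \<open>h c p $ i $ j\<close> is
  \<open>h\<^sub>i\<^sub>j(p)\<close> in the chart \<open>c\<close>. The components in different charts are related by the usual
  transformation law; only values at charts of the atlas and points of their domains matter.\<close>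

type_synonym ('a, 'n) tensor2 = "('a, 'n) chart \<Rightarrow> 'a \<Rightarrow> real ^ 'n ^ 'n"

definition jacobian ::
  "('a, 'n::finite) chart \<Rightarrow> ('a, 'n) chart \<Rightarrow> 'a \<Rightarrow> real ^ 'n ^ 'n"
where
  "jacobian c c' p = matrix (frechet_derivative (coord c' \<circ> coord_inv c) (at (coord c p)))"

definition symmetric_tensor :: "('a, 'n::finite) chart set \<Rightarrow> ('a, 'n) tensor2 \<Rightarrow> bool" where
  "symmetric_tensor A h \<longleftrightarrow>
     (\<forall>c\<in>A. smooth_on (coord c ` chart_dom c) (\<lambda>u. h c (coord_inv c u))) \<and>
     (\<forall>c\<in>A. \<forall>c'\<in>A. \<forall>p \<in> chart_dom c \<inter> chart_dom c'.
        h c p = transpose (jacobian c c' p) ** h c' p ** jacobian c c' p) \<and>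
     (\<forall>c\<in>A. \<forall>p\<in>chart_dom c. transpose (h c p) = h c p)"

definition riemannian_metric :: "('a, 'n::finite) chart set \<Rightarrow> ('a, 'n) tensor2 \<Rightarrow> bool" where
  "riemannian_metric A h \<longleftrightarrow>
     symmetric_tensor A h \<and>
     (\<forall>c\<in>A. \<forall>p\<in>chart_dom c. \<forall>v. v \<noteq> 0 \<longrightarrow> 0 < v \<bullet> (h c p *v v))"

subsection \<open>Ricci tensor\<close>

definition partial :: "'n \<Rightarrow> (real ^ 'n \<Rightarrow> real) \<Rightarrow> real ^ 'n::finite \<Rightarrow> real" where
  "partial i f u = frechet_derivative f (at u) (axis i 1)"

text \<open>\<open>christoffel G k i j\<close> is \<open>\<Gamma>\<^sup>k\<^sub>i\<^sub>j\<close> of the metric with coordinate expression \<open>G\<close>. The sign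
  convention for the Ricci tensor is the one that is positive on round spheres.\<close>

definition christoffel ::
  "(real ^ 'n \<Rightarrow> real ^ 'n ^ 'n) \<Rightarrow> 'n \<Rightarrow> 'n \<Rightarrow> 'n \<Rightarrow> real ^ 'n::finite \<Rightarrow> real"
where
  "christoffel G k i j u =
     (1/2) * (\<Sum>l\<in>UNIV. matrix_inv (G u) $ k $ l *
       (partial i (\<lambda>v. G v $ j $ l) u + partial j (\<lambda>v. G v $ i $ l) u
          - partial l (\<lambda>v. G v $ i $ j) u))"

definition ricci_coord ::
  "(real ^ 'n \<Rightarrow> real ^ 'n ^ 'n) \<Rightarrow> real ^ 'n::finite \<Rightarrow> real ^ 'n ^ 'n"
where
  "ricci_coord G u = (\<chi> i j.
     (\<Sum>k\<in>UNIV. partial k (christoffel G k i j) u)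
     - (\<Sum>k\<in>UNIV. partial j (christoffel G k i k) u)
     + (\<Sum>k\<in>UNIV. \<Sum>l\<in>UNIV. christoffel G k k l u * christoffel G l i j u)
     - (\<Sum>k\<in>UNIV. \<Sum>l\<in>UNIV. christoffel G k j l u * christoffel G l i k u))"

definition ricci :: "('a, 'n::finite) tensor2 \<Rightarrow> ('a, 'n) tensor2" where
  "ricci h c p = ricci_coord (\<lambda>u. h c (coord_inv c u)) (coord c p)"

subsection \<open>The dissipative hyperbolic geometric flow\<close>

text \<open>Time-dependent tensors are considered for \<open>t \<ge> 0\<close>; at \<open>t = 0\<close> the time derivative is
  one-sided.\<close>

definition time_deriv ::
  "(real \<Rightarrow> ('a, 'n::finite) tensor2) \<Rightarrow> real \<Rightarrow> ('a, 'n) tensor2"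
where
  "time_deriv g t c p = vector_derivative (\<lambda>s. g s c p) (at t within {0..})"

definition inverse_metric :: "('a, 'n::finite) tensor2 \<Rightarrow> ('a, 'n) tensor2" where
  "inverse_metric h c p = matrix_inv (h c p)"

text \<open>The full contraction \<open>S\<^sup>p\<^sup>q T\<^sub>p\<^sub>q\<close>.\<close>

definition contract :: "real ^ 'n ^ 'n \<Rightarrow> real ^ 'n ^ 'n::finite \<Rightarrow> real" where
  "contract S T = (\<Sum>p\<in>UNIV. \<Sum>q\<in>UNIV. S $ p $ q * T $ p $ q)"

definition dhgf_equation ::
  "('a, 'n::finite) chart set \<Rightarrow> real \<Rightarrow> (real \<Rightarrow> ('a, 'n) tensor2) \<Rightarrow> real \<Rightarrow> bool"
where
  "dhgf_equation A d g t \<longleftrightarrow>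
     (\<forall>c\<in>A. \<forall>x\<in>chart_dom c. \<forall>i j.
        let G = g t c x;
            Ginv = inverse_metric (g t) c x;
            dG = time_deriv g t c x;
            dGinv = time_deriv (\<lambda>s. inverse_metric (g s)) t c x
        in time_deriv (time_deriv g) t c x $ i $ j =
             - 2 * ricci (g t) c x $ i $ j
             + 2 * (\<Sum>p\<in>UNIV. \<Sum>q\<in>UNIV. Ginv $ p $ q * dG $ i $ p * dG $ j $ q)
             - (d + 2 * contract Ginv dG) * dG $ i $ j
             + 1 / (real CARD('n) - 1)
                 * ((contract Ginv dG)\<^sup>2 + contract dGinv dG) * G $ i $ j)"

definition smooth_metric_family ::
  "('a, 'n::finite) chart set \<Rightarrow> real set \<Rightarrow> (real \<Rightarrow> ('a, 'n) tensor2) \<Rightarrow> bool"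
where
  "smooth_metric_family A I g \<longleftrightarrow>
     (\<forall>t\<in>I. riemannian_metric A (g t)) \<and>
     (\<forall>c\<in>A. smooth_on ((coord c ` chart_dom c) \<times> I) (\<lambda>(u, t). g t c (coord_inv c u)))"

definition initial_data ::
  "('a, 'n::finite) chart set \<Rightarrow> ('a, 'n) tensor2 \<Rightarrow> ('a, 'n) tensor2 \<Rightarrow>
    (real \<Rightarrow> ('a, 'n) tensor2) \<Rightarrow> bool"
where
  "initial_data A g0 k0 g \<longleftrightarrow>
     (\<forall>c\<in>A. \<forall>x\<in>chart_dom c.
        g 0 c x = g0 c x \<and>
        ((\<lambda>t. g t c x) has_vector_derivative k0 c x) (at 0 within {0..}))"

definition dhgf_solution ::
  "('a, 'n::finite) chart set \<Rightarrow> real \<Rightarrow> ('a, 'n) tensor2 \<Rightarrow> ('a, 'n) tensor2 \<Rightarrow> real set \<Rightarrow>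
    (real \<Rightarrow> ('a, 'n) tensor2) \<Rightarrow> bool"
where
  "dhgf_solution A d g0 k0 I g \<longleftrightarrow>
     smooth_metric_family A I g \<and> (\<forall>t\<in>I. dhgf_equation A d g t) \<and> initial_data A g0 k0 g"

subsection \<open>The homothetic evolution\<close>

text \<open>\<open>conformal_factor d lam mu\<close> is the solution of \<open>r'' + d r' = - 2 lam\<close>, \<open>r 0 = 1\<close>,
  \<open>r' 0 = mu\<close>. For \<open>g(t) = r(t) g(0)\<close> with \<open>g(0)\<close> Einstein, the flow equation reads
  \<open>r'' + d r' + 2 lam + (n - 2) r'\<^sup>2 / r = 0\<close>, so it coincides with this linear equation
  precisely for \<open>n = 2\<close>.\<close>

definition conformal_factor :: "real \<Rightarrow> real \<Rightarrow> real \<Rightarrow> real \<Rightarrow> real" where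
  "conformal_factor d lam mu t =
     1 - (2 * lam / d) * t - (mu / d + 2 * lam / d\<^sup>2) * (exp (- d * t) - 1)"

definition homothetic_on ::
  "('a, 'n::finite) chart set \<Rightarrow> real set \<Rightarrow> (real \<Rightarrow> real) \<Rightarrow> (real \<Rightarrow> ('a, 'n) tensor2) \<Rightarrow> bool"
where
  "homothetic_on A I r g \<longleftrightarrow> (\<forall>t\<in>I. \<forall>c\<in>A. \<forall>x\<in>chart_dom c. g t c x = r t *\<^sub>R g 0 c x)"

text \<open>The filter \<open>F\<close> is \<open>at_left T\<close> for \<open>I = [0,T)\<close> and \<open>at_top\<close> for \<open>I = [0,\<infinity>)\<close>.\<close>

definition shrinks_homothetically ::
  "('a, 'n::finite) chart set \<Rightarrow> real set \<Rightarrow> real filter \<Rightarrow> (real \<Rightarrow> ('a, 'n) tensor2) \<Rightarrow> bool"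
where
  "shrinks_homothetically A I F g \<longleftrightarrow>
     (\<exists>r. homothetic_on A I r g \<and> (\<forall>t\<in>I. 0 < r t) \<and> (r \<longlongrightarrow> 0) F)"

end

theory Submission
  imports Defs
begin

text \<open>Everything follows from the scalar function \<open>\<rho>\<close>, because the evolving metric is
  \<open>\<rho>(t) h\<close> for the fixed metric \<open>h = g(0)\<close>.

  The flow equation holds on a surface because each of its terms is a multiple of \<open>h\<close>. The Ricci
  tensor does not see constant factors (\<open>ricci_homothetic\<close>), so it stays equal to \<open>\<lambda> h\<close>; the
  remaining terms are contractions of \<open>h\<close> with its inverse. For \<open>n = 2\<close> those that are quadratic
  in \<open>\<rho>'\<close> cancel, and what is left is \<open>\<rho>'' + d \<rho>' = - 2 \<lambda>\<close>, the linear equation solved by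
  \<open>\<rho>\<close> (\<open>dhgf_equation_homothetic\<close>).

  The metric is positive definite as long as \<open>\<rho>\<close> is positive, and it is smooth in space and
  time because \<open>\<rho>\<close> and \<open>h\<close> are (\<open>smooth_metric_family_homothetic\<close>). Hence the alternatives are a
  matter of the sign of \<open>\<rho>\<close>. Since \<open>\<rho>(0) = 1\<close>, a single later time with \<open>\<rho> \<le> 0\<close> gives a
  first zero \<open>T\<close>, where the metric collapses (\<open>first_zero\<close>). Such a time exists for \<open>\<lambda> > 0\<close>
  because the term \<open>- 2 \<lambda> t / d\<close> dominates; for \<open>\<lambda> = 0\<close> and \<open>\<mu> < - d\<close> because
  \<open>\<rho> \<rightarrow> 1 + \<mu> / d < 0\<close>; in the third case it is the critical point of \<open>\<rho>\<close> in the hypothesis. In the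
  remaining cases \<open>\<rho>\<close> stays positive (\<open>conformal_factor_pos_otherwise\<close>): it is at least
  \<open>e\<^sup>-\<^sup>d\<^sup>t\<close> if \<open>\<lambda> = 0\<close>, with equality for \<open>\<mu> = - d\<close>; it is increasing if \<open>\<lambda> < 0 \<le> \<mu>\<close>; and it is
  convex with a positive minimum if \<open>\<lambda>, \<mu> < 0\<close>.\<close>

section \<open>Scaling a smooth map by a smooth function of time\<close>

lemma Ck_on_open_cong:
  assumes "open W" "\<And>x. x \<in> W \<Longrightarrow> f x = g x" "Ck_on_open k W f"
  shows "Ck_on_open k W g"
  using assms(2,3)
proof (induction k arbitrary: f g)
  case 0
  then show ?case by (simp cong: continuous_on_cong)
next
  case (Suc k)
  have D: "f differentiable (at x)" if "x \<in> W" for x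
    using Suc.prems(2) that \<open>open W\<close> by (auto simp: differentiable_on_eq_differentiable_at)
  have "frechet_derivative f (at x) = frechet_derivative g (at x)" if "x \<in> W" for x
    using frechet_derivative_transform_within_open[OF D[OF that] \<open>open W\<close> that] Suc.prems(1) by blast
  moreover have "g differentiable_on W"
    using Suc.prems by (auto simp: differentiable_on_def intro: differentiable_transform_within[OF _ zero_less_one])
  ultimately show ?case
    using Suc.IH[of "\<lambda>x. frechet_derivative f (at x) v" "\<lambda>x. frechet_derivative g (at x) v" for v] Suc.prems(2)
    by auto
qed

lemma Ck_on_open_has_derivative:
  assumes "Ck_on_open (Suc k) W f" "open W" "x \<in> W"
  shows "(f has_derivative frechet_derivative f (at x)) (at x)"
  using assms by (simp add: differentiable_on_eq_differentiable_at frechet_derivative_works)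

lemma Ck_on_open_SucI:
  assumes "open W" "\<And>x. x \<in> W \<Longrightarrow> (f has_derivative f' x) (at x)"
    and "\<And>v. Ck_on_open k W (\<lambda>x. f' x v)"
  shows "Ck_on_open (Suc k) W f"
proof -
  have "f' x = frechet_derivative f (at x)" if "x \<in> W" for x
    using assms(2)[OF that] by (rule frechet_derivative_at)
  then have "Ck_on_open k W (\<lambda>x. frechet_derivative f (at x) v)" for v
    using Ck_on_open_cong[OF assms(1) _ assms(3)[of v]] by simp
  then show ?thesis
    using assms(1,2) by (auto simp: differentiable_on_eq_differentiable_at differentiable_def)
qed

lemma Ck_on_open_Suc_imp:
  assumes "open W" "Ck_on_open (Suc k) W f"
  shows "Ck_on_open k W f"
  using assms(2)
proof (induction k arbitrary: f)
  case 0
  then show ?case by (simp add: differentiable_imp_continuous_on)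
next
  case (Suc k)
  then show ?case by (metis Ck_on_open.simps(2))
qed

lemma Ck_on_open_add:
  assumes "open W" "Ck_on_open k W f" "Ck_on_open k W g"
  shows "Ck_on_open k W (\<lambda>x. f x + g x)"
  using assms(2,3)
proof (induction k arbitrary: f g)
  case 0
  then show ?case by (simp add: continuous_on_add)
next
  case (Suc k)
  show ?case
  proof (rule Ck_on_open_SucI[OF assms(1)])
    fix x assume "x \<in> W"
    then show "((\<lambda>x. f x + g x) has_derivative
        (\<lambda>v. frechet_derivative f (at x) v + frechet_derivative g (at x) v)) (at x)"
      using Suc.prems assms(1) by (blast intro: has_derivative_add Ck_on_open_has_derivative)
  next
    fix v
    show "Ck_on_open k W (\<lambda>x. frechet_derivative f (at x) v + frechet_derivative g (at x) v)"
      using Suc by simp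
  qed
qed

text \<open>By the product rule, the derivative of \<open>r(t) F(u)\<close> in the direction \<open>(v, s)\<close> is the sum
  of two products of the same shape, which is what makes an induction on \<open>k\<close> work.\<close>

lemma Ck_on_open_scaleR_Times:
  fixes F :: "'a::real_normed_vector \<Rightarrow> 'b::real_normed_vector" and r :: "real \<Rightarrow> real"
  assumes "open W" "Ck_on_open k W F" "Ck_on_open k UNIV r"
  shows "Ck_on_open k (W \<times> UNIV) (\<lambda>p. r (snd p) *\<^sub>R F (fst p))"
  using assms(2,3)
proof (induction k arbitrary: F r)
  case 0
  then show ?case
    by (auto intro!: continuous_intros intro: continuous_on_compose2[of UNIV r] continuous_on_compose2[of W F])
next
  case (Suc k)
  have op: "open (W \<times> (UNIV :: real set))" using assms(1) by (simp add: open_Times)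
  show ?case
  proof (rule Ck_on_open_SucI[OF op])
    fix p :: "'a \<times> real" assume p: "p \<in> W \<times> UNIV"
    have F: "(F has_derivative frechet_derivative F (at (fst p))) (at (fst p))"
      using Ck_on_open_has_derivative[OF Suc.prems(1) assms(1)] p by auto
    have r: "(r has_derivative frechet_derivative r (at (snd p))) (at (snd p))"
      using Ck_on_open_has_derivative[OF Suc.prems(2)] by auto
    have F': "((\<lambda>q. F (fst q)) has_derivative (\<lambda>v. frechet_derivative F (at (fst p)) (fst v))) (at p)"
      using has_derivative_compose[OF has_derivative_fst[OF has_derivative_ident] F] .
    have r': "((\<lambda>q. r (snd q)) has_derivative (\<lambda>v. frechet_derivative r (at (snd p)) (snd v))) (at p)"
      using has_derivative_compose[OF has_derivative_snd[OF has_derivative_ident] r] .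
    show "((\<lambda>p. r (snd p) *\<^sub>R F (fst p)) has_derivative
      (\<lambda>v. r (snd p) *\<^sub>R frechet_derivative F (at (fst p)) (fst v)
          + frechet_derivative r (at (snd p)) (snd v) *\<^sub>R F (fst p))) (at p)"
      using has_derivative_scaleR[OF r' F'] .
  next
    fix v :: "'a \<times> real"
    have 1: "Ck_on_open k W (\<lambda>u. frechet_derivative F (at u) (fst v))"
      "Ck_on_open k UNIV (\<lambda>t. frechet_derivative r (at t) (snd v))"
      using Suc.prems by auto
    have 2: "Ck_on_open k W F" "Ck_on_open k UNIV r"
      using Suc.prems Ck_on_open_Suc_imp assms(1) open_UNIV by blast+
    show "Ck_on_open k (W \<times> UNIV) (\<lambda>p. r (snd p) *\<^sub>R frechet_derivative F (at (fst p)) (fst v)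
          + frechet_derivative r (at (snd p)) (snd v) *\<^sub>R F (fst p))"
      by (rule Ck_on_open_add[OF op Suc.IH[OF 1(1) 2(2)] Suc.IH[OF 2(1) 1(2)]])
  qed
qed

lemma Ck_on_open_scaleR_const:
  fixes F :: "'a::real_normed_vector \<Rightarrow> 'b::real_normed_vector"
  assumes "open W" "Ck_on_open k W F"
  shows "Ck_on_open k W (\<lambda>u. r *\<^sub>R F u)"
  using assms(2)
proof (induction k arbitrary: F)
  case 0
  then show ?case by (auto intro!: continuous_intros)
next
  case (Suc k)
  show ?case
  proof (rule Ck_on_open_SucI[OF assms(1)])
    show "((\<lambda>u. r *\<^sub>R F u) has_derivative (\<lambda>v. r *\<^sub>R frechet_derivative F (at x) v)) (at x)" if "x \<in> W" for x
      using Ck_on_open_has_derivative[OF Suc.prems assms(1) that] by (rule has_derivative_scaleR_right)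
  qed (use Suc in auto)
qed

text \<open>Functions of the form \<open>a + b t + c e\<^sup>-\<^sup>d\<^sup>t\<close> are closed under differentiation.\<close>

lemma Ck_on_open_affine_plus_exp:
  "Ck_on_open k UNIV (\<lambda>t::real. a + b * t + c * exp (- d * t) :: real)"
proof (induction k arbitrary: a b c)
  case 0
  then show ?case by (auto intro!: continuous_intros)
next
  case (Suc k)
  show ?case
  proof (rule Ck_on_open_SucI[where f' = "\<lambda>t v. b * v + 0 * t + (- c * d * v) * exp (- d * t)"])
    show "((\<lambda>t. a + b * t + c * exp (- d * t)) has_derivative
        (\<lambda>v. b * v + 0 * x + (- c * d * v) * exp (- d * x))) (at x)" for x
      by (auto intro!: derivative_eq_intros)
    show "Ck_on_open k UNIV (\<lambda>t. b * v + 0 * t + (- c * d * v) * exp (- d * t))" for v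
      by (rule Suc.IH)
  qed simp
qed

section \<open>The conformal factor\<close>

lemma Ck_on_open_conformal_factor: "Ck_on_open k UNIV (conformal_factor d lam mu)"
proof -
  let ?k = "mu / d + 2 * lam / d\<^sup>2"
  have "conformal_factor d lam mu = (\<lambda>t. (1 + ?k) + (- 2 * lam / d) * t + (- ?k) * exp (- d * t))"
    by (rule ext) (simp add: conformal_factor_def algebra_simps diff_divide_distrib)
  then show ?thesis using Ck_on_open_affine_plus_exp[of k "1 + ?k" "- 2 * lam / d" "- ?k" d] by metis
qed

definition conformal_rate :: "real \<Rightarrow> real \<Rightarrow> real \<Rightarrow> real \<Rightarrow> real" where
  "conformal_rate d lam mu t = - 2 * lam / d + (mu + 2 * lam / d) * exp (- d * t)"

lemma conformal_factor_0 [simp]: "conformal_factor d lam mu 0 = 1"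
  by (simp add: conformal_factor_def)

lemma conformal_factor_deriv:
  assumes "d > 0"
  shows "(conformal_factor d lam mu has_real_derivative conformal_rate d lam mu t) (at t within S)"
  unfolding conformal_factor_def conformal_rate_def using assms
  by (auto intro!: derivative_eq_intros simp: field_simps power2_eq_square)

lemma conformal_rate_deriv:
  assumes "d > 0"
  shows "(conformal_rate d lam mu has_real_derivative (- 2 * lam - d * conformal_rate d lam mu t)) (at t within S)"
  unfolding conformal_rate_def using assms
  by (auto intro!: derivative_eq_intros simp: field_simps)

lemma continuous_on_conformal_factor: "continuous_on S (conformal_factor d lam mu)"
  unfolding conformal_factor_def by (cases "d = 0") (auto intro!: continuous_intros)

text \<open>The zero set is compact, so it has a least element.\<close>

lemma first_zero:
  fixes r :: "real \<Rightarrow> real"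
  assumes cont: "continuous_on {0..s} r" and "0 < r 0" "0 < s" "r s \<le> 0"
  obtains T where "0 < T" "T \<le> s" "r T = 0" "\<And>t. 0 \<le> t \<Longrightarrow> t < T \<Longrightarrow> 0 < r t"
proof -
  let ?Z = "{t \<in> {0..s}. r t = 0}"
  have zero: "\<exists>z. 0 \<le> z \<and> z \<le> t \<and> r z = 0" if "0 \<le> t" "t \<le> s" "r t \<le> 0" for t
    using that \<open>0 < r 0\<close>
    by (intro IVT2') (auto intro: continuous_on_subset[OF cont])
  have "closed ?Z"
    using continuous_closed_preimage_constant[OF cont] by simp
  moreover have "{0..s} \<inter> ?Z = ?Z" by blast
  ultimately have "compact ?Z"
    using compact_Int_closed[OF compact_Icc[of 0 s], of ?Z] by simp
  moreover have "?Z \<noteq> {}"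
    using zero[of s] assms by auto
  ultimately have "\<exists>T\<in>?Z. \<forall>t\<in>?Z. T \<le> t"
    by (rule compact_attains_inf)
  then obtain T where T: "T \<in> ?Z" "\<And>t. t \<in> ?Z \<Longrightarrow> T \<le> t"
    by blast
  have pos: "0 < r t" if t: "0 \<le> t" "t < T" for t
  proof (rule ccontr)
    assume "\<not> 0 < r t"
    moreover have "t \<le> s" using T(1) t by simp
    ultimately obtain z where z: "0 \<le> z" "z \<le> t" "r z = 0"
      using zero[of t] t(1) by (meson not_less)
    then have "z \<in> ?Z" using \<open>t \<le> s\<close> by simp
    then show False using T(2)[of z] z t by linarith
  qed
  have "0 < T"
    using T(1) \<open>0 < r 0\<close> by (cases "T = 0") auto
  then show thesis using T(1) pos by (intro that) auto
qed

lemma conformal_factor_nonpos_pos_Einstein: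
  assumes "d > 0" "lam > 0"
  shows "\<exists>s>0. conformal_factor d lam mu s \<le> 0"
proof -
  let ?k = "mu / d + 2 * lam / d\<^sup>2"
  \<comment> \<open>Since \<open>k (1 - e\<^sup>-\<^sup>d\<^sup>s) \<le> |k|\<close>, the linear term dominates from this time on.\<close>
  define s where "s = (1 + \<bar>?k\<bar>) * d / (2 * lam)"
  have "0 < 1 + \<bar>?k\<bar>" by linarith
  then have "s > 0" unfolding s_def using assms by (intro divide_pos_pos mult_pos_pos) auto
  have "?k * (1 - exp (- d * s)) \<le> \<bar>?k\<bar> * 1"
    using \<open>s > 0\<close> assms(1) by (intro mult_mono) auto
  moreover have "(2 * lam / d) * s = 1 + \<bar>?k\<bar>"
    using assms by (simp add: s_def)
  ultimately have "conformal_factor d lam mu s \<le> 0"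
    unfolding conformal_factor_def by argo
  with \<open>s > 0\<close> show ?thesis by blast
qed

lemma conformal_factor_nonpos_Ricci_flat:
  assumes "d > 0" "mu < - d"
  shows "\<exists>s>0. conformal_factor d 0 mu s \<le> 0"
proof -
  \<comment> \<open>The factor is \<open>1 + (\<mu> / d) (1 - e\<^sup>-\<^sup>d\<^sup>s)\<close>, and this is its zero.\<close>
  define s where "s = - ln (1 + d / mu) / d"
  have q: "0 < 1 + d / mu" "1 + d / mu < 1" using assms by (auto simp: field_simps)
  then have "s > 0" using assms by (auto simp: s_def intro!: divide_neg_pos)
  moreover have "exp (- d * s) = 1 + d / mu"
    using q assms by (simp add: s_def)
  then have "conformal_factor d 0 mu s = 0"
    using assms by (simp add: conformal_factor_def)
  ultimately show ?thesis by force
qed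

text \<open>This time is the zero of \<open>conformal_rate\<close>; it is positive because the argument of the logarithm
  lies between 0 and 1.\<close>

lemma critical_time:
  fixes d lam mu :: real
  assumes "d > 0" "lam < 0" "mu < 0"
  defines "s \<equiv> - (1 / d) * ln (2 * lam / (2 * lam + d * mu))"
  shows "s > 0" "exp (- d * s) = 2 * lam / (2 * lam + d * mu)"
proof -
  have dm: "d * mu < 0" using assms by (simp add: mult_pos_neg)
  then have q: "0 < 2 * lam / (2 * lam + d * mu)" "2 * lam / (2 * lam + d * mu) < 1"
    using assms by (auto simp: field_simps intro!: divide_neg_neg)
  then show "s > 0" using assms(1) by (simp add: s_def divide_neg_pos)
  show "exp (- d * s) = 2 * lam / (2 * lam + d * mu)"
    using q assms(1) by (simp add: s_def)
qed

text \<open>For \<open>\<lambda>, \<mu> < 0\<close> the factor is convex, so the tangent line of the exponential at the critical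
  time shows that the critical value is the global minimum.\<close>

lemma conformal_factor_minimum:
  assumes "d > 0" "lam < 0" "mu < 0"
  shows "conformal_factor d lam mu (- (1 / d) * ln (2 * lam / (2 * lam + d * mu))) \<le> conformal_factor d lam mu t"
proof -
  define s where "s = - (1 / d) * ln (2 * lam / (2 * lam + d * mu))"
  let ?k = "mu / d + 2 * lam / d\<^sup>2"
  have e: "exp (- d * s) = 2 * lam / (2 * lam + d * mu)"
    using critical_time(2)[OF assms] by (simp add: s_def)
  have dm: "d * mu < 0" using assms by (simp add: mult_pos_neg)
  have k: "?k = (2 * lam + d * mu) / d\<^sup>2" using assms by (simp add: field_simps power2_eq_square)
  then have kneg: "?k < 0" using assms dm by (auto intro!: divide_neg_pos)
  have ke: "?k * exp (- d * s) = 2 * lam / d\<^sup>2" unfolding k e using assms dm by simp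
  have "exp (- d * t) = exp (- d * s) * exp (- d * (t - s))"
    by (simp flip: exp_add add: algebra_simps)
  moreover have "1 - d * (t - s) \<le> exp (- d * (t - s))"
    using exp_ge_add_one_self[of "- d * (t - s)"] by simp
  ultimately have "exp (- d * s) * (1 - d * (t - s)) \<le> exp (- d * t)" by simp
  then have "?k * exp (- d * t) \<le> ?k * (exp (- d * s) * (1 - d * (t - s)))"
    using kneg by (intro mult_left_mono_neg) auto
  also have "\<dots> = 2 * lam / d\<^sup>2 - (2 * lam / d) * (t - s)"
    unfolding mult.assoc[symmetric] ke using assms by (simp add: field_simps power2_eq_square)
  finally have "?k * exp (- d * t) \<le> 2 * lam / d\<^sup>2 - (2 * lam / d) * (t - s)" .
  then show ?thesis
    unfolding s_def[symmetric] conformal_factor_def using ke by argo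
qed

lemma conformal_factor_pos_otherwise:
  assumes "d > 0" "t \<ge> 0" "\<not> lam > 0" "\<not> (lam = 0 \<and> mu < - d)"
    and c: "\<not> (lam < 0 \<and> mu < 0 \<and>
      conformal_factor d lam mu (- (1 / d) * ln (2 * lam / (2 * lam + d * mu))) \<le> 0)"
  shows "0 < conformal_factor d lam mu t"
proof -
  have "lam = 0 \<and> mu \<ge> - d \<or> lam < 0 \<and> mu < 0 \<or> lam < 0 \<and> mu \<ge> 0"
    using assms by linarith
  then show ?thesis
  proof (elim disjE conjE)
    assume l: "lam = 0" "mu \<ge> - d"
    have "- 1 * (1 - exp (- d * t)) \<le> (mu / d) * (1 - exp (- d * t))"
      using l assms by (intro mult_right_mono) (auto simp: field_simps)
    then have "exp (- d * t) \<le> conformal_factor d lam mu t"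
      using l by (simp add: conformal_factor_def algebra_simps)
    then show ?thesis using exp_gt_zero[of "- d * t"] by linarith
  next
    assume "lam < 0" "mu < 0"
    then show ?thesis using c conformal_factor_minimum[of d lam mu t] assms(1) by linarith
  next
    assume l: "lam < 0" "mu \<ge> 0"
    have rate: "0 \<le> conformal_rate d lam mu x" if "0 \<le> x" for x
    proof -
      have "conformal_rate d lam mu x = mu * exp (- d * x) + (- 2 * lam / d) * (1 - exp (- d * x))"
        unfolding conformal_rate_def by argo
      moreover have "0 \<le> - 2 * lam / d" using l assms(1) by (intro divide_nonneg_pos) auto
      moreover have "0 \<le> 1 - exp (- d * x)" using assms(1) that by simp
      ultimately show ?thesis
        using l(2) by (simp only: add_nonneg_nonneg mult_nonneg_nonneg exp_ge_zero)
    qed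
    have "conformal_factor d lam mu 0 \<le> conformal_factor d lam mu t"
      by (rule DERIV_nonneg_imp_nondecreasing[OF assms(2)])
        (rule exI, rule conjI, rule conformal_factor_deriv[OF assms(1)], rule rate)
    then show ?thesis by simp
  qed
qed

section \<open>Scaling invariance of the Ricci tensor\<close>

lemma invertible_if_pos_def:
  fixes H :: "real ^ 'n ^ 'n"
  assumes "\<And>v. v \<noteq> 0 \<Longrightarrow> 0 < v \<bullet> (H *v v)"
  shows "invertible H"
proof -
  have "H *v x = 0 \<longrightarrow> x = 0" for x using assms[of x] by (cases "x = 0") auto
  then show ?thesis unfolding invertible_left_inverse matrix_left_invertible_ker by blast
qed

lemma invertible_matrix_inv:
  assumes "invertible (H :: real ^ 'n ^ 'n)"
  shows "H ** matrix_inv H = mat 1" "matrix_inv H ** H = mat 1"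
  using assms unfolding invertible_def matrix_inv_def by (metis (mono_tags, lifting) someI_ex)+

lemma matrix_inv_scaleR:
  fixes H :: "real ^ 'n ^ 'n"
  assumes "invertible H" "r \<noteq> 0"
  shows "matrix_inv (r *\<^sub>R H) = (1 / r) *\<^sub>R matrix_inv H"
proof -
  let ?K = "(1 / r) *\<^sub>R matrix_inv H"
  have l: "?K ** (r *\<^sub>R H) = mat 1" and r: "(r *\<^sub>R H) ** ?K = mat 1"
    using assms by (simp_all add: matrix_scalar_ac scalar_matrix_assoc[symmetric] invertible_matrix_inv)
  then have "invertible (r *\<^sub>R H)" unfolding invertible_def by blast
  then have "matrix_inv (r *\<^sub>R H) = (?K ** (r *\<^sub>R H)) ** matrix_inv (r *\<^sub>R H)"
    using l by simp
  also have "\<dots> = ?K"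
    using invertible_matrix_inv[OF \<open>invertible (r *\<^sub>R H)\<close>] by (simp only: matrix_mul_assoc[symmetric]) simp
  finally show ?thesis .
qed

text \<open>The value of \<open>frechet_derivative\<close> is a choice from the set of derivatives at the point, and this
  set depends only on the germ of the function. Hence equal Christoffel symbols have equal partial
  derivatives.\<close>

lemma partial_cong:
  assumes "open U" "u \<in> U" "\<And>v. v \<in> U \<Longrightarrow> f v = g v"
  shows "partial i f u = partial i g u"
proof -
  have "(f has_derivative D) (at u) \<longleftrightarrow> (g has_derivative D) (at u)" for D
    using has_derivative_transform_within_open[OF _ assms(1,2)] assms(3) by metis
  then show ?thesis by (simp add: partial_def frechet_derivative_def)
qed

lemma partial_scale:
  assumes "f differentiable (at u)"
  shows "partial i (\<lambda>v. r * f v) u = r * partial i f u"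
proof -
  have "((\<lambda>v. r * f v) has_derivative (\<lambda>v. r * frechet_derivative f (at u) v)) (at u)"
    using assms by (intro has_derivative_mult_right) (simp add: frechet_derivative_works[symmetric])
  from frechet_derivative_at[OF this] show ?thesis by (simp add: partial_def fun_eq_iff)
qed

lemma differentiable_entry:
  fixes G :: "'a::real_normed_vector \<Rightarrow> real ^ 'n ^ 'm"
  assumes "G differentiable (at u)"
  shows "(\<lambda>v. G v $ i $ j) differentiable (at u)"
proof -
  from assms obtain D where "(G has_derivative D) (at u)" unfolding differentiable_def by blast
  from bounded_linear.has_derivative[OF bounded_linear_vec_nth
      bounded_linear.has_derivative[OF bounded_linear_vec_nth this]]
  show ?thesis unfolding differentiable_def by blast
qed

text \<open>The Christoffel symbols contain one factor of the inverse metric and one of the metric, so a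
  constant factor cancels; the Ricci tensor of a homothetic metric is therefore unchanged.\<close>

lemma christoffel_scaleR:
  fixes G G' :: "real ^ 'n::finite \<Rightarrow> real ^ 'n ^ 'n"
  assumes U: "open U" "u \<in> U" and "r \<noteq> 0"
    and eq: "\<And>v. v \<in> U \<Longrightarrow> G' v = r *\<^sub>R G v"
    and "G differentiable (at u)" "invertible (G u)"
  shows "christoffel G' k i j u = christoffel G k i j u"
proof -
  have p: "partial m (\<lambda>v. G' v $ a $ b) u = r * partial m (\<lambda>v. G v $ a $ b) u" for m a b
  proof -
    have "partial m (\<lambda>v. G' v $ a $ b) u = partial m (\<lambda>v. r * G v $ a $ b) u"
      by (rule partial_cong[OF U]) (simp add: eq)
    then show ?thesis using partial_scale[OF differentiable_entry[OF assms(5)]] by simp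
  qed
  have "matrix_inv (G' u) = (1 / r) *\<^sub>R matrix_inv (G u)"
    using assms by (simp add: matrix_inv_scaleR)
  then have "matrix_inv (G' u) $ k $ l * (r * a + r * b - r * c) = matrix_inv (G u) $ k $ l * (a + b - c)"
    for l a b c
    using \<open>r \<noteq> 0\<close> by (simp add: field_simps)
  then show ?thesis unfolding christoffel_def p by simp
qed

lemma ricci_coord_scaleR:
  fixes G G' :: "real ^ 'n::finite \<Rightarrow> real ^ 'n ^ 'n"
  assumes U: "open U" "u \<in> U" and "r \<noteq> 0"
    and "\<And>v. v \<in> U \<Longrightarrow> G' v = r *\<^sub>R G v"
    and "\<And>v. v \<in> U \<Longrightarrow> G differentiable (at v)" "\<And>v. v \<in> U \<Longrightarrow> invertible (G v)"
  shows "ricci_coord G' u = ricci_coord G u"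
proof -
  have c: "christoffel G' k i j v = christoffel G k i j v" if "v \<in> U" for k i j v
    using assms that by (intro christoffel_scaleR[where U = U and r = r]) auto
  have "partial m (christoffel G' k i j) u = partial m (christoffel G k i j) u" for m k i j
    by (rule partial_cong[OF U c])
  then show ?thesis unfolding ricci_coord_def using c[OF U(2)] by simp
qed

section \<open>Homothetic metrics\<close>

lemma smooth_on_imp_differentiable:
  assumes "smooth_on U f" "open U" "u \<in> U"
  shows "f differentiable (at u)"
proof -
  obtain W F where W: "open W" "u \<in> W" "Ck_on_open (Suc 0) W F" "\<forall>y\<in>W \<inter> U. F y = f y"
    using assms unfolding smooth_on_def by blast
  have "(F has_derivative frechet_derivative F (at u)) (at u)"
    using Ck_on_open_has_derivative[OF W(3,1,2)] .
  then have "(f has_derivative frechet_derivative F (at u)) (at u)"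
    by (rule has_derivative_transform_within_open[where s = "W \<inter> U"]) (use W assms in auto)
  then show ?thesis unfolding differentiable_def by blast
qed

lemma riemannian_metric_scaleR:
  assumes "riemannian_metric A h" "0 < r"
    and eq: "\<And>c p. c \<in> A \<Longrightarrow> p \<in> chart_dom c \<Longrightarrow> h' c p = r *\<^sub>R h c p"
  shows "riemannian_metric A h'"
proof -
  have sym: "symmetric_tensor A h" and pos: "\<forall>c\<in>A. \<forall>p\<in>chart_dom c. \<forall>v. v \<noteq> 0 \<longrightarrow> 0 < v \<bullet> (h c p *v v)"
    using assms(1) unfolding riemannian_metric_def by blast+
  have "smooth_on (coord c ` chart_dom c) (\<lambda>u. h' c (coord_inv c u))" if "c \<in> A" for c
    unfolding smooth_on_def
  proof
    fix u assume u: "u \<in> coord c ` chart_dom c"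
    have "smooth_on (coord c ` chart_dom c) (\<lambda>u. h c (coord_inv c u))"
      using sym that unfolding symmetric_tensor_def by (elim conjE bspec)
    from bspec[OF this[unfolded smooth_on_def] u] obtain W F where W: "open W" "u \<in> W" "\<forall>k. Ck_on_open k W F"
      "\<forall>y\<in>W \<inter> coord c ` chart_dom c. F y = h c (coord_inv c y)"
      by (elim exE conjE)
    have "\<forall>k. Ck_on_open k W (\<lambda>u. r *\<^sub>R F u)"
      using W Ck_on_open_scaleR_const by blast
    moreover have "\<forall>y\<in>W \<inter> coord c ` chart_dom c. r *\<^sub>R F y = h' c (coord_inv c y)"
    proof
      fix y assume y: "y \<in> W \<inter> coord c ` chart_dom c"
      then have "coord_inv c y \<in> chart_dom c" by (intro inv_into_into) blast
      from eq[OF that this] show "r *\<^sub>R F y = h' c (coord_inv c y)" using W(4) y by metis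
    qed
    ultimately show "\<exists>W F. open W \<and> u \<in> W \<and> (\<forall>k. Ck_on_open k W F) \<and>
        (\<forall>y\<in>W \<inter> coord c ` chart_dom c. F y = h' c (coord_inv c y))"
      using W(1,2) by blast
  qed
  moreover have "h' c p = transpose (jacobian c c' p) ** h' c' p ** jacobian c c' p"
    if "c \<in> A" "c' \<in> A" "p \<in> chart_dom c \<inter> chart_dom c'" for c c' p
  proof -
    have "h c p = transpose (jacobian c c' p) ** h c' p ** jacobian c c' p"
      using sym that unfolding symmetric_tensor_def by blast
    then show ?thesis
      using that by (simp add: eq matrix_scalar_ac scalar_matrix_assoc[symmetric])
  qed
  moreover have "transpose (h' c p) = h' c p" if "c \<in> A" "p \<in> chart_dom c" for c p
  proof -
    have "transpose (h c p) = h c p" using sym that unfolding symmetric_tensor_def by blast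
    then show ?thesis using that by (simp add: eq transpose_scalar)
  qed
  moreover have "0 < v \<bullet> (h' c p *v v)" if "c \<in> A" "p \<in> chart_dom c" "v \<noteq> 0" for c p v
    using pos that \<open>0 < r\<close> by (simp add: eq scaleR_matrix_vector_assoc[symmetric])
  ultimately show ?thesis
    unfolding riemannian_metric_def symmetric_tensor_def by blast
qed

lemma smooth_metric_family_homothetic:
  assumes "riemannian_metric A h" "\<And>k. Ck_on_open k UNIV r"
    and eq: "\<And>t c p. t \<in> I \<Longrightarrow> c \<in> A \<Longrightarrow> p \<in> chart_dom c \<Longrightarrow> g t c p = r t *\<^sub>R h c p"
    and "\<And>t. t \<in> I \<Longrightarrow> riemannian_metric A (g t)"
  shows "smooth_metric_family A I g"
proof -
  have "smooth_on ((coord c ` chart_dom c) \<times> I) (\<lambda>(u, t). g t c (coord_inv c u))" if c: "c \<in> A" for c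
    unfolding smooth_on_def
  proof
    fix p assume p: "p \<in> (coord c ` chart_dom c) \<times> I"
    then have u: "fst p \<in> coord c ` chart_dom c" by auto
    have "smooth_on (coord c ` chart_dom c) (\<lambda>u. h c (coord_inv c u))"
      using assms(1) c unfolding riemannian_metric_def symmetric_tensor_def by (elim conjE bspec)
    from bspec[OF this[unfolded smooth_on_def] u] obtain W F where W: "open W" "fst p \<in> W" "\<forall>k. Ck_on_open k W F"
      "\<forall>y\<in>W \<inter> coord c ` chart_dom c. F y = h c (coord_inv c y)"
      by (elim exE conjE)
    \<comment> \<open>As \<open>r\<close> is smooth on the whole line, the extension works at boundary points of \<open>I\<close> too.\<close>
    let ?F = "\<lambda>q. r (snd q) *\<^sub>R F (fst q)"
    have "\<forall>k. Ck_on_open k (W \<times> UNIV) ?F"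
      using W Ck_on_open_scaleR_Times assms(2) by blast
    moreover have "?F q = (\<lambda>(u, t). g t c (coord_inv c u)) q"
      if "q \<in> (W \<times> UNIV) \<inter> ((coord c ` chart_dom c) \<times> I)" for q
    proof -
      have q: "fst q \<in> W \<inter> coord c ` chart_dom c" "snd q \<in> I" using that by auto
      then have "coord_inv c (fst q) \<in> chart_dom c" by (intro inv_into_into) blast
      from eq[OF q(2) c this] show ?thesis using W(4) q(1) by (metis case_prod_beta)
    qed
    ultimately show "\<exists>W F. open W \<and> p \<in> W \<and> (\<forall>k. Ck_on_open k W F) \<and>
        (\<forall>q\<in>W \<inter> (coord c ` chart_dom c \<times> I). F q = (\<lambda>(u, t). g t c (coord_inv c u)) q)"
      using W(1,2) p by (intro exI[of _ "W \<times> UNIV"] exI[of _ ?F]) (auto simp: open_Times mem_Times_iff)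
  qed
  then show ?thesis using assms(4) unfolding smooth_metric_family_def by blast
qed

text \<open>Away from the image of its chart, \<open>coord_inv\<close> takes arbitrary values, so the two coordinate
  expressions are proportional only on that image; since it is open, this suffices.\<close>

lemma ricci_homothetic:
  assumes "smooth_manifold M A" "riemannian_metric A h" "r \<noteq> 0"
    and eq: "\<And>c p. c \<in> A \<Longrightarrow> p \<in> chart_dom c \<Longrightarrow> h' c p = r *\<^sub>R h c p"
    and c: "c \<in> A" "x \<in> chart_dom c"
  shows "ricci h' c x = ricci h c x"
  unfolding ricci_def
proof (rule ricci_coord_scaleR[where U = "coord c ` chart_dom c" and r = r])
  let ?U = "coord c ` chart_dom c"
  show op: "open ?U" using assms(1) c unfolding smooth_manifold_def by blast
  show "coord c x \<in> ?U" using c by blast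
  fix v assume v: "v \<in> ?U"
  then have dom: "coord_inv c v \<in> chart_dom c" by (rule inv_into_into)
  show "h' c (coord_inv c v) = r *\<^sub>R h c (coord_inv c v)" using eq[OF c(1) dom] .
  show "(\<lambda>u. h c (coord_inv c u)) differentiable at v"
    using assms(2) c(1) op v unfolding riemannian_metric_def symmetric_tensor_def
    by (blast intro: smooth_on_imp_differentiable)
  show "invertible (h c (coord_inv c v))"
    using assms(2) c(1) dom unfolding riemannian_metric_def by (blast intro: invertible_if_pos_def)
qed (rule assms(3))

section \<open>The flow equation for a homothetic family on a surface\<close>

lemma contract_scaleR: "contract (a *\<^sub>R S) (b *\<^sub>R T) = a * b * contract S T"
  by (simp add: contract_def sum_distrib_left mult_ac)

lemma contract_inverse_self:
  fixes H :: "real ^ 'n ^ 'n"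
  assumes "invertible H" "transpose H = H"
  shows "contract (matrix_inv H) H = real CARD('n)"
proof -
  have sym: "H $ p $ q = H $ q $ p" for p q
    using arg_cong[OF assms(2), of "\<lambda>M. M $ q $ p"] by (simp add: transpose_def)
  have "contract (matrix_inv H) H = (\<Sum>p\<in>UNIV. (matrix_inv H ** H) $ p $ p)"
    unfolding contract_def matrix_matrix_mult_def vec_lambda_beta
    by (intro sum.cong refl arg_cong2[where f = "(*)"] sym)
  also have "\<dots> = real CARD('n)"
    by (simp add: invertible_matrix_inv[OF assms(1)] mat_def)
  finally show ?thesis .
qed

lemma double_contraction_inverse:
  fixes H :: "real ^ 'n ^ 'n"
  assumes "invertible H" "transpose H = H"
  shows "(\<Sum>p\<in>UNIV. \<Sum>q\<in>UNIV. matrix_inv H $ p $ q * H $ i $ p * H $ j $ q) = H $ i $ j"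
proof -
  have sym: "H $ p $ q = H $ q $ p" for p q
    using arg_cong[OF assms(2), of "\<lambda>M. M $ q $ p"] by (simp add: transpose_def)
  have "(\<Sum>p\<in>UNIV. \<Sum>q\<in>UNIV. matrix_inv H $ p $ q * H $ i $ p * H $ j $ q)
      = (\<Sum>p\<in>UNIV. H $ i $ p * (\<Sum>q\<in>UNIV. matrix_inv H $ p $ q * H $ q $ j))"
    unfolding sum_distrib_left sym[of j] by (intro sum.cong refl) (simp add: mult_ac)
  also have "\<dots> = (H ** (matrix_inv H ** H)) $ i $ j"
    by (simp add: matrix_matrix_mult_def)
  finally show ?thesis by (simp add: invertible_matrix_inv[OF assms(1)])
qed

lemma time_deriv_eqI:
  assumes "t \<ge> 0" "((\<lambda>s. g s c p) has_vector_derivative D) (at t within {0..})"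
  shows "time_deriv g t c p = D"
proof -
  have "{t<..} \<subseteq> {0..}" using assms(1) by auto
  then have "at t within {0..} \<noteq> bot"
    using at_le[of "{t<..}" "{0..}" t] trivial_limit_at_right_real[of t] by (metis bot_unique)
  then show ?thesis unfolding time_deriv_def using assms(2) by (rule vector_derivative_within)
qed

lemma has_vector_derivative_scaleR_const:
  assumes "(r has_real_derivative D) (at t within S)"
  shows "((\<lambda>s. r s *\<^sub>R H) has_vector_derivative D *\<^sub>R H) (at t within S)"
  using has_vector_derivative_scaleR[OF assms has_vector_derivative_const[of H]] by simp

text \<open>With \<open>g = \<rho> h\<close> every term of the equation is a multiple of \<open>h\<close>. In dimension \<open>n\<close> the terms
  quadratic in \<open>\<rho>'\<close> add up to \<open>(2 - 2 n + n) \<rho>'\<^sup>2 / \<rho>\<close>, which vanishes for \<open>n = 2\<close> and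
  leaves the linear equation \<open>\<rho>'' = - 2 \<lambda> - d \<rho>'\<close>.\<close>

lemma dhgf_equation_homothetic:
  fixes A :: "('a, 'n::finite) chart set" and g :: "real \<Rightarrow> ('a, 'n) tensor2" and d lam mu :: real
  defines "\<rho> \<equiv> conformal_factor d lam mu"
  assumes n: "CARD('n) = 2" and "d > 0" and M: "smooth_manifold M A"
    and h: "riemannian_metric A h" and gt: "riemannian_metric A (g t)" and "t \<ge> 0"
    and eq: "\<And>s c x. s \<ge> 0 \<Longrightarrow> c \<in> A \<Longrightarrow> x \<in> chart_dom c \<Longrightarrow> g s c x = \<rho> s *\<^sub>R h c x"
    and ric: "\<And>c x. c \<in> A \<Longrightarrow> x \<in> chart_dom c \<Longrightarrow> ricci h c x = lam *\<^sub>R h c x"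
  shows "dhgf_equation A d g t"
  unfolding dhgf_equation_def
proof (intro ballI allI)
  fix c x i j assume c: "c \<in> A" "x \<in> chart_dom c"
  define H where "H = h c x"
  define K where "K = matrix_inv H"
  define r where "r = \<rho> t"
  define r' where "r' = conformal_rate d lam mu t"
  have inv: "invertible H"
    using h c unfolding riemannian_metric_def H_def by (blast intro: invertible_if_pos_def)
  have sym: "transpose H = H"
    using h c unfolding riemannian_metric_def symmetric_tensor_def H_def by blast
  have gH: "g s c x = \<rho> s *\<^sub>R H" if "s \<ge> 0" for s
    using eq[OF that c] by (simp add: H_def)
  have "r > 0"
  proof -
    let ?v = "axis undefined 1 :: real ^ 'n"
    have "0 < ?v \<bullet> (H *v ?v)" "0 < ?v \<bullet> (g t c x *v ?v)"
      using h gt c unfolding riemannian_metric_def H_def by (simp_all add: axis_eq_0_iff)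
    then show ?thesis
      using gH[OF \<open>t \<ge> 0\<close>] by (simp add: r_def scaleR_matrix_vector_assoc[symmetric] zero_less_mult_iff)
  qed
  have dG: "time_deriv g s c x = conformal_rate d lam mu s *\<^sub>R H" if "s \<ge> 0" for s
  proof (rule time_deriv_eqI[OF that])
    have "((\<lambda>s. \<rho> s *\<^sub>R H) has_vector_derivative conformal_rate d lam mu s *\<^sub>R H) (at s within {0..})"
      unfolding \<rho>_def by (rule has_vector_derivative_scaleR_const[OF conformal_factor_deriv[OF \<open>d > 0\<close>]])
    then show "((\<lambda>s. g s c x) has_vector_derivative conformal_rate d lam mu s *\<^sub>R H) (at s within {0..})"
      by (rule has_vector_derivative_transform[rotated 2]) (simp_all add: that gH)
  qed
  have ddG: "time_deriv (time_deriv g) t c x = (- 2 * lam - d * r') *\<^sub>R H"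
  proof (rule time_deriv_eqI[OF \<open>t \<ge> 0\<close>])
    have "((\<lambda>s. conformal_rate d lam mu s *\<^sub>R H) has_vector_derivative (- 2 * lam - d * r') *\<^sub>R H) (at t within {0..})"
      unfolding r'_def by (rule has_vector_derivative_scaleR_const[OF conformal_rate_deriv[OF \<open>d > 0\<close>]])
    then show "((\<lambda>s. time_deriv g s c x) has_vector_derivative (- 2 * lam - d * r') *\<^sub>R H) (at t within {0..})"
      by (rule has_vector_derivative_transform[rotated 2]) (simp_all add: \<open>t \<ge> 0\<close> dG)
  qed
  have Ginv: "inverse_metric (g s) c x = (1 / \<rho> s) *\<^sub>R K" if "s \<ge> 0" "\<rho> s \<noteq> 0" for s
    using that inv by (simp add: inverse_metric_def gH K_def matrix_inv_scaleR)
  have dGinv: "time_deriv (\<lambda>s. inverse_metric (g s)) t c x = (- (r' / r\<^sup>2)) *\<^sub>R K"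
  proof (rule time_deriv_eqI[OF \<open>t \<ge> 0\<close>])
    \<comment> \<open>The formula for the inverse needs \<open>\<rho> \<noteq> 0\<close>, which continuity provides near \<open>t\<close>.\<close>
    have "isCont \<rho> t"
      using conformal_factor_deriv[OF \<open>d > 0\<close>] unfolding \<rho>_def by (rule DERIV_isCont)
    then obtain e where e: "e > 0" "\<And>s. dist t s < e \<Longrightarrow> \<rho> s \<noteq> 0"
      using continuous_at_avoid[of t \<rho> 0] \<open>r > 0\<close> by (auto simp: r_def)
    have "((\<lambda>s. 1 / \<rho> s) has_real_derivative - (r' / r\<^sup>2)) (at t within {0..})"
      using \<open>r > 0\<close> unfolding r_def r'_def \<rho>_def
      by (auto intro!: derivative_eq_intros conformal_factor_deriv[OF \<open>d > 0\<close>] simp: power2_eq_square)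
    from has_vector_derivative_scaleR_const[OF this, of K]
    show "((\<lambda>s. inverse_metric (g s) c x) has_vector_derivative (- (r' / r\<^sup>2)) *\<^sub>R K) (at t within {0..})"
    proof (rule has_vector_derivative_transform_within[OF _ e(1)])
      show "t \<in> {0..}" using \<open>t \<ge> 0\<close> by simp
      show "(1 / \<rho> s) *\<^sub>R K = inverse_metric (g s) c x" if "s \<in> {0..}" "dist s t < e" for s
        using Ginv[of s] e(2)[of s] that by (simp add: dist_commute)
    qed
  qed
  have R: "ricci (g t) c x = lam *\<^sub>R H"
    using ricci_homothetic[OF M h, of r "g t"] \<open>r > 0\<close> \<open>t \<ge> 0\<close> eq ric c by (simp add: H_def r_def)
  have tr: "contract K H = 2"
    unfolding K_def using contract_inverse_self[OF inv sym] n by simp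
  have "(\<Sum>p\<in>UNIV. \<Sum>q\<in>UNIV. ((1 / r) *\<^sub>R K) $ p $ q * (r' *\<^sub>R H) $ i $ p * (r' *\<^sub>R H) $ j $ q)
      = (r'\<^sup>2 / r) * (\<Sum>p\<in>UNIV. \<Sum>q\<in>UNIV. K $ p $ q * H $ i $ p * H $ j $ q)"
    unfolding sum_distrib_left by (intro sum.cong refl) (simp add: power2_eq_square)
  also have "\<dots> = (r'\<^sup>2 / r) * H $ i $ j"
    unfolding K_def double_contraction_inverse[OF inv sym] ..
  finally have quad: "(\<Sum>p\<in>UNIV. \<Sum>q\<in>UNIV. ((1 / r) *\<^sub>R K) $ p $ q * (r' *\<^sub>R H) $ i $ p * (r' *\<^sub>R H) $ j $ q)
      = (r'\<^sup>2 / r) * H $ i $ j" .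
  have cancel: "(- 2 * lam - d * r') * y = - 2 * (lam * y) + 2 * ((r'\<^sup>2 / r) * y)
      - (d + 2 * (1 / r * r' * 2)) * (r' * y)
      + 1 / (2 - 1) * ((1 / r * r' * 2)\<^sup>2 + - (r' / r\<^sup>2) * r' * 2) * (r * y)" for y
    using \<open>r > 0\<close> by (simp add: field_simps power2_eq_square)
  have G: "g t c x = r *\<^sub>R H" and I: "inverse_metric (g t) c x = (1 / r) *\<^sub>R K"
    and D: "time_deriv g t c x = r' *\<^sub>R H"
    using gH Ginv dG \<open>t \<ge> 0\<close> \<open>r > 0\<close> by (simp_all add: r_def r'_def)
  show "let G = g t c x;
            Ginv = inverse_metric (g t) c x;
            dG = time_deriv g t c x;
            dGinv = time_deriv (\<lambda>s. inverse_metric (g s)) t c x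
        in time_deriv (time_deriv g) t c x $ i $ j =
             - 2 * ricci (g t) c x $ i $ j
             + 2 * (\<Sum>p\<in>UNIV. \<Sum>q\<in>UNIV. Ginv $ p $ q * dG $ i $ p * dG $ j $ q)
             - (d + 2 * contract Ginv dG) * dG $ i $ j
             + 1 / (real CARD('n) - 1)
                 * ((contract Ginv dG)\<^sup>2 + contract dGinv dG) * G $ i $ j"
    unfolding Let_def G I D R ddG dGinv quad contract_scaleR tr
    using cancel[of "H $ i $ j"] n by simp
qed

section \<open>Behaviour of the evolving metric\<close>

theorem theorem2p2:
  fixes M :: "'a topology"
    and A :: "('a, 'n::finite) chart set"
    and g0 k0 :: "('a, 'n) tensor2"
    and g :: "real \<Rightarrow> ('a, 'n) tensor2"
    and d lam mu :: real
  defines "\<rho> \<equiv> conformal_factor d lam mu"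
  defines "cond_a \<equiv> lam > 0"
    and "cond_b \<equiv> lam = 0 \<and> mu < - d"
    and "cond_c \<equiv> lam < 0 \<and> mu < 0 \<and> \<rho> (- (1 / d) * ln (2 * lam / (2 * lam + d * mu))) \<le> 0"
  assumes "CARD('n) \<ge> 2"
    and "smooth_manifold M A"
    and "d > 0"
    and "riemannian_metric A g0"
    and "symmetric_tensor A k0"
    and "initial_data A g0 k0 g"
    and "\<forall>c\<in>A. \<forall>x\<in>chart_dom c. ricci (g 0) c x = lam *\<^sub>R g 0 c x"
    and "\<forall>c\<in>A. \<forall>x\<in>chart_dom c. time_deriv g 0 c x = mu *\<^sub>R g 0 c x"
    and "homothetic_on A {0..} \<rho> g"
  shows "(CARD('n) = 2 \<longrightarrow>
           (\<forall>T>0. (\<forall>t\<in>{0..<T}. riemannian_metric A (g t)) \<longrightarrow> dhgf_solution A d g0 k0 {0..<T} g)) \<and>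
         (cond_a \<or> cond_b \<or> cond_c \<longrightarrow>
           (\<exists>T>0. shrinks_homothetically A {0..<T} (at_left T) g)) \<and>
         (\<not> (cond_a \<or> cond_b \<or> cond_c) \<longrightarrow> smooth_metric_family A {0..} g) \<and>
         (lam = 0 \<and> mu = - d \<longrightarrow>
           smooth_metric_family A {0..} g \<and> shrinks_homothetically A {0..} at_top g)"
proof -
  define h where "h = g 0"
  have h0: "h c x = g0 c x" if "c \<in> A" "x \<in> chart_dom c" for c x
    using \<open>initial_data A g0 k0 g\<close> that unfolding initial_data_def h_def by blast
  have h: "riemannian_metric A h"
    by (rule riemannian_metric_scaleR[OF \<open>riemannian_metric A g0\<close>, of 1]) (simp_all add: h0)
  have hom: "g t c x = \<rho> t *\<^sub>R h c x" if "t \<ge> 0" "c \<in> A" "x \<in> chart_dom c" for t c x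
    using \<open>homothetic_on A {0..} \<rho> g\<close> that unfolding homothetic_on_def h_def by (meson atLeast_iff)
  have ric: "ricci h c x = lam *\<^sub>R h c x" if "c \<in> A" "x \<in> chart_dom c" for c x
    using \<open>\<forall>c\<in>A. \<forall>x\<in>chart_dom c. ricci (g 0) c x = lam *\<^sub>R g 0 c x\<close> that unfolding h_def by blast
  have Ck: "Ck_on_open k UNIV \<rho>" for k
    unfolding \<rho>_def by (rule Ck_on_open_conformal_factor)
  have family: "smooth_metric_family A I g" if "I \<subseteq> {0..}" "\<And>t. t \<in> I \<Longrightarrow> riemannian_metric A (g t)" for I
  proof (rule smooth_metric_family_homothetic[OF h Ck _ that(2)])
    show "g t c x = \<rho> t *\<^sub>R h c x" if "t \<in> I" "c \<in> A" "x \<in> chart_dom c" for t c x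
      using hom that \<open>I \<subseteq> {0..}\<close> by (meson atLeast_iff subsetD)
  qed
  have global: "smooth_metric_family A {0..} g" if "\<And>t. t \<ge> 0 \<Longrightarrow> 0 < \<rho> t"
  proof (rule family)
    show "riemannian_metric A (g t)" if "t \<in> {0..}" for t
      using riemannian_metric_scaleR[OF h, of "\<rho> t" "g t"] hom that \<open>\<And>t. t \<ge> 0 \<Longrightarrow> 0 < \<rho> t\<close>
      by (meson atLeast_iff)
  qed simp

  have "dhgf_solution A d g0 k0 {0..<T} g"
    if "CARD('n) = 2" "\<forall>t\<in>{0..<T}. riemannian_metric A (g t)" for T
  proof -
    have "dhgf_equation A d g t" if t: "t \<in> {0..<T}" for t
    proof (rule dhgf_equation_homothetic[OF \<open>CARD('n) = 2\<close> \<open>d > 0\<close> \<open>smooth_manifold M A\<close> h])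
      show "riemannian_metric A (g t)" using \<open>\<forall>t\<in>{0..<T}. riemannian_metric A (g t)\<close> t by blast
      show "0 \<le> t" using t by simp
      show "g s c x = conformal_factor d lam mu s *\<^sub>R h c x"
        if "0 \<le> s" "c \<in> A" "x \<in> chart_dom c" for s c x
        using hom[OF that] unfolding \<rho>_def .
    qed (rule ric)
    moreover have "smooth_metric_family A {0..<T} g"
    proof (rule family)
      show "{0..<T} \<subseteq> {0..}" by (rule subsetI) simp
    qed (use that(2) in blast)
    ultimately show ?thesis
      using \<open>initial_data A g0 k0 g\<close> unfolding dhgf_solution_def by blast
  qed
  moreover have "\<exists>T>0. shrinks_homothetically A {0..<T} (at_left T) g" if "cond_a \<or> cond_b \<or> cond_c"
  proof -
    have "\<exists>s>0. \<rho> s \<le> 0"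
      using that conformal_factor_nonpos_pos_Einstein[OF \<open>d > 0\<close>] conformal_factor_nonpos_Ricci_flat[OF \<open>d > 0\<close>]
        critical_time(1)[OF \<open>d > 0\<close>]
      unfolding cond_a_def cond_b_def cond_c_def \<rho>_def by blast
    then obtain s where "s > 0" "\<rho> s \<le> 0" by blast
    then obtain T where T: "0 < T" "\<rho> T = 0" "\<And>t. 0 \<le> t \<Longrightarrow> t < T \<Longrightarrow> 0 < \<rho> t"
      using first_zero[of s \<rho>] continuous_on_conformal_factor unfolding \<rho>_def
      by (metis conformal_factor_0 zero_less_one)
    have "isCont \<rho> T"
      using conformal_factor_deriv[OF \<open>d > 0\<close>] unfolding \<rho>_def by (rule DERIV_isCont)
    then have "(\<rho> \<longlongrightarrow> 0) (at_left T)"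
      using T(2) by (metis continuous_within filterlim_at_split)
    moreover have "homothetic_on A {0..<T} \<rho> g"
      using \<open>homothetic_on A {0..} \<rho> g\<close> unfolding homothetic_on_def by (meson atLeastLessThan_iff atLeast_iff)
    ultimately have "shrinks_homothetically A {0..<T} (at_left T) g"
      using T(3) unfolding shrinks_homothetically_def by (intro exI[of _ \<rho>]) auto
    with T(1) show ?thesis by blast
  qed
  moreover have "smooth_metric_family A {0..} g" if "\<not> (cond_a \<or> cond_b \<or> cond_c)"
  proof (rule global)
    fix t :: real assume "t \<ge> 0"
    then show "0 < \<rho> t"
      using that conformal_factor_pos_otherwise[OF \<open>d > 0\<close>]
      unfolding cond_a_def cond_b_def cond_c_def \<rho>_def by blast
  qed
  moreover have "smooth_metric_family A {0..} g \<and> shrinks_homothetically A {0..} at_top g"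
    if "lam = 0 \<and> mu = - d"
  proof -
    have \<rho>: "\<rho> = (\<lambda>t. exp (- d * t))"
      using that \<open>d > 0\<close> by (auto simp: \<rho>_def conformal_factor_def)
    have "(\<rho> \<longlongrightarrow> 0) at_top"
      unfolding \<rho> using \<open>d > 0\<close>
      by (intro filterlim_compose[OF exp_at_bot] filterlim_tendsto_neg_mult_at_bot[OF tendsto_const _ filterlim_ident])
        simp
    then have "shrinks_homothetically A {0..} at_top g"
      using \<open>homothetic_on A {0..} \<rho> g\<close> unfolding shrinks_homothetically_def by (intro exI[of _ \<rho>]) (simp add: \<rho>)
    then show ?thesis using global by (simp add: \<rho>)
  qed
  ultimately show ?thesis by blast
qed

end
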